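(* Let $\mathbf 1_j\otimes f_S\in\mathcal A_{\bar i}$ be some $S$-local operator relative to frame $R_i$. Then $\mathbf 1_j\otimes f_S\in\mathcal A_{\bar i}^{X}$ for some bilocal unitary $X$ (and some orientations $g_i,g_j\in\mathcal G$) if and only if it lies in the image of $\hat\Pi_{\mathbf t}$, i.e. if and only if $f_S$ is translation invariant, $[f_S,U_S^g]=0$ for all $g\in\mathcal G$. In particular, $\mathbf 1_j\otimes f_S\in\mathcal A_{\bar i}^{\mathbf t}$ resides in exactly all those subalgebras $\mathcal A_{\bar i}^{X}$ with $X$ of the form $X=Y_j\otimes Z_S$, where the $S$-unitary $Z_S$ commutes with $f_S$, $[Z_S,f_S]=0$, and $Y_j$ is an arbitrary $R_j$-unitary.
   Context: $\mathcal G$ is a finite abelian group, $\mathcal G\neq\{e\}$. For $i=1,2$ (two ideal quantum reference frames $R_1,R_2$), $\mathcal H_i=\ell^2(\mathcal G)$ has orthonormal basis $\{|g\rangle_i\}_{g\in\mathcal G}$. $\mathcal H_S$ is a (possibly infinite-dimensional) complex Hilbert space carrying a unitary representation $g\mapsto U_S^g$ of $\mathcal G$. For $i\neq j$ in $\{1,2\}$, $\mathcal H_{\bar i}=\mathcal H_j\otimes\mathcal H_S$ (the description of $R_j$ and $S$ relative to $R_i$) and $\mathcal A_{\bar i}$ is the algebra of (bounded) linear operators on it. For a unitary $W$ write $\hat W(A)=WAW^\dagger$. For $g_i,g_j\in\mathcal G$ define the unitary $\mathbf U_{\bar i}^{g_i,g_j}=\sum_{g\in\mathcal G}|g_ig\rangle\langle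 g_jg^{-1}|_j\otimes U_S^g$ on $\mathcal H_{\bar i}$ (it represents the change of quantum reference frame from $R_i$ in orientation $g_i$ to $R_j$ in orientation $g_j$). For a bilocal unitary $X=Y_j\otimes Z_S$ (with $Y_j$, $Z_S$ unitary on $\mathcal H_j$, $\mathcal H_S$), the TPS-invariant subalgebra is $$\mathcal A_{\bar i}^{X}=\{f\in\mathcal A_{\bar i}:\ \hat{\mathbf U}_{\bar i}^{g_i,g_j}(f)=\hat X^\dagger(f)\},\qquad \hat X^\dagger(f)=X^\dagger fX,$$ with the dependence on $g_i,g_j$ suppressed in the notation. $\hat\Pi_{\mathbf t}(f)=\frac1{|\mathcal G|}\sum_{g\in\mathcal G}(\mathbf 1_j\otimes U_S^g)f(\mathbf 1_j\otimes U_S^{g^{-1}})$ for $f\in\mathcal A_{\bar i}$, and $\mathcal A_{\bar i}^{\mathbf t}=\hat\Pi_{\mathbf t}(\mathcal A_{\bar i})$. *)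

theory Defs
  imports "HOL-Analysis.Analysis"
begin

section \<open>Complex inner product spaces and Hilbert spaces\<close>

text \<open>The inner product is antilinear in its first argument. Positive definiteness is contained
  in \<open>cinner_self\<close>, which also ties the norm to the inner product.\<close>

class complex_inner = real_normed_vector +
  fixes scaleC :: "complex \<Rightarrow> 'a \<Rightarrow> 'a" (infixr "*\<^sub>C" 75)
    and cinner :: "'a \<Rightarrow> 'a \<Rightarrow> complex"
  assumes scaleC_add_right: "c *\<^sub>C (x + y) = c *\<^sub>C x + c *\<^sub>C y"
    and scaleC_add_left: "(c + d) *\<^sub>C x = c *\<^sub>C x + d *\<^sub>C x"
    and scaleC_scaleC: "c *\<^sub>C d *\<^sub>C x = (c * d) *\<^sub>C x"
    and scaleC_of_real: "complex_of_real r *\<^sub>C x = r *\<^sub>R x"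
    and cinner_commute: "cinner x y = cnj (cinner y x)"
    and cinner_add_right: "cinner x (y + z) = cinner x y + cinner x z"
    and cinner_scaleC_right: "cinner x (c *\<^sub>C y) = c * cinner x y"
    and cinner_self: "cinner x x = complex_of_real ((norm x)\<^sup>2)"

class chilbert_space = complex_inner + banach

instantiation complex :: chilbert_space
begin
definition scaleC_complex :: "complex \<Rightarrow> complex \<Rightarrow> complex"
  where "scaleC_complex c x = c * x"
definition cinner_complex :: "complex \<Rightarrow> complex \<Rightarrow> complex"
  where "cinner_complex x y = cnj x * y"
instance
proof
  fix x :: complex
  show "cinner x x = complex_of_real ((norm x)\<^sup>2)"
    unfolding cinner_complex_def by (metis complex_norm_square mult.commute)
qed (simp_all add: scaleC_complex_def cinner_complex_def algebra_simps scaleR_conv_of_real)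
end

text \<open>For a finite index type, \<open>'a ^ 'i\<close> is the Hilbert space direct sum of copies of \<open>'a\<close>;
  in particular \<open>complex ^ 'i\<close> is \<open>\<ell>\<^sup>2('i)\<close>. Its norm is the one already
  provided by the library.\<close>

instantiation vec :: (complex_inner, finite) complex_inner
begin
definition scaleC_vec :: "complex \<Rightarrow> 'a ^ 'b \<Rightarrow> 'a ^ 'b"
  where "scaleC_vec c x = (\<chi> i. c *\<^sub>C (x $ i))"
definition cinner_vec :: "'a ^ 'b \<Rightarrow> 'a ^ 'b \<Rightarrow> complex"
  where "cinner_vec x y = (\<Sum>i\<in>UNIV. cinner (x $ i) (y $ i))"
instance
proof
  fix x y :: "'a ^ 'b"
  show "cinner x y = cnj (cinner y x)"
    unfolding cinner_vec_def cnj_sum by (rule sum.cong[OF refl], rule cinner_commute)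
  show "cinner x x = complex_of_real ((norm x)\<^sup>2)"
    by (simp add: cinner_vec_def cinner_self norm_vec_def L2_set_def sum_nonneg)
qed (simp_all add: vec_eq_iff scaleC_vec_def cinner_vec_def scaleC_add_right scaleC_add_left
      scaleC_scaleC scaleC_of_real cinner_add_right cinner_scaleC_right sum.distrib sum_distrib_left)
end

instance vec :: (chilbert_space, finite) chilbert_space ..

lemma scaleC_one [simp]: "1 *\<^sub>C x = (x :: 'a::complex_inner)"
  using scaleC_of_real[of 1 x] by simp

lemma scaleC_zero_left [simp]: "0 *\<^sub>C x = (0 :: 'a::complex_inner)"
  using scaleC_of_real[of 0 x] by simp

lemma scaleC_zero_right [simp]: "c *\<^sub>C 0 = (0 :: 'a::complex_inner)"
  using scaleC_add_right[of c 0 0] by simp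

lemma scaleC_sum_right: "c *\<^sub>C sum f A = (\<Sum>i\<in>A. c *\<^sub>C (f i :: 'a::complex_inner))"
  by (induction A rule: infinite_finite_induct) (simp_all add: scaleC_add_right)

lemma scaleC_sum_left: "sum f A *\<^sub>C x = (\<Sum>i\<in>A. f i *\<^sub>C (x :: 'a::complex_inner))"
  by (induction A rule: infinite_finite_induct) (simp_all add: scaleC_add_left)

lemma cinner_scaleC_left: "cinner (c *\<^sub>C x) y = cnj c * cinner x (y :: 'a::complex_inner)"
  by (simp add: cinner_commute[of "c *\<^sub>C x" y] cinner_commute[of x y] cinner_scaleC_right)

lemma cinner_zero_right [simp]: "cinner x (0 :: 'a::complex_inner) = 0"
  using cinner_add_right[of x 0 0] by simp

lemma cinner_diff_right: "cinner x (y - z) = cinner x y - cinner x (z :: 'a::complex_inner)"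
  using cinner_add_right[of x "y - z" z] by simp

lemma cinner_eqI:
  assumes "\<And>x. cinner x y = cinner x (z :: 'a::complex_inner)"
  shows "y = z"
  using cinner_self[of "y - z"] assms cinner_diff_right[of "y - z" y z] by simp


section \<open>Operators\<close>

definition bounded_clinear :: "('a::complex_inner \<Rightarrow> 'b::complex_inner) \<Rightarrow> bool"
  where "bounded_clinear f \<longleftrightarrow> bounded_linear f \<and> (\<forall>c x. f (c *\<^sub>C x) = c *\<^sub>C f x)"

text \<open>Meaningful whenever an adjoint exists, in particular for every unitary
  (see \<open>unitary_cadjoint\<close> below).\<close>

definition cadjoint :: "('a::complex_inner \<Rightarrow> 'b::complex_inner) \<Rightarrow> 'b \<Rightarrow> 'a"
  where "cadjoint f = (SOME f'. \<forall>x y. cinner (f' x) y = cinner x (f y))"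

definition unitary :: "('a::complex_inner \<Rightarrow> 'a) \<Rightarrow> bool"
  where "unitary W \<longleftrightarrow>
    bounded_clinear W \<and> surj W \<and> (\<forall>x y. cinner (W x) (W y) = cinner x y)"

definition conj_by :: "('a::complex_inner \<Rightarrow> 'a) \<Rightarrow> ('a \<Rightarrow> 'a) \<Rightarrow> 'a \<Rightarrow> 'a"
  where "conj_by W A = W \<circ> A \<circ> cadjoint W"

definition commutator :: "('a::complex_inner \<Rightarrow> 'a) \<Rightarrow> ('a \<Rightarrow> 'a) \<Rightarrow> 'a \<Rightarrow> 'a"
  where "commutator A B = (\<lambda>x. A (B x) - B (A x))"

definition unitary_rep :: "('g::group_add \<Rightarrow> 'a::complex_inner \<Rightarrow> 'a) \<Rightarrow> bool"
  where "unitary_rep U \<longleftrightarrow>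
    (\<forall>g. unitary (U g)) \<and> U 0 = id \<and> (\<forall>g h. U (g + h) = U g \<circ> U h)"

lemma cadjoint_eqI:
  assumes "\<And>x y. cinner (f' x) y = cinner x (f y)"
  shows "cadjoint f = f'"
proof -
  have "\<forall>x y. cinner (cadjoint f x) y = cinner x (f y)"
    unfolding cadjoint_def by (rule someI[of _ f']) (use assms in blast)
  then have "cinner y (cadjoint f x) = cinner y (f' x)" for x y
    by (simp add: cinner_commute[of y] assms)
  then have "cadjoint f x = f' x" for x
    by (rule cinner_eqI)
  then show ?thesis
    by (rule ext)
qed

lemma unitary_cadjoint:
  assumes "unitary W"
  shows "cinner (cadjoint W x) y = cinner x (W y)"
    and "W \<circ> cadjoint W = id" and "cadjoint W \<circ> W = id"
proof -
  have surj: "surj W" and iso: "\<And>x y. cinner (W x) (W y) = cinner x y"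
    using assms by (auto simp: unitary_def)
  have "inj W"
    by (rule injI, rule cinner_eqI) (metis iso)
  have adj: "cinner (inv W x) y = cinner x (W y)" for x y
    by (metis iso surj surj_f_inv_f)
  then have eq: "cadjoint W = inv W"
    by (rule cadjoint_eqI)
  show "cinner (cadjoint W x) y = cinner x (W y)"
    using adj eq by simp
  show "W \<circ> cadjoint W = id" "cadjoint W \<circ> W = id"
    using surj \<open>inj W\<close> eq by (auto simp: surj_iff)
qed


section \<open>The tensor product of \<open>\<ell>\<^sup>2('g)\<close> with a Hilbert space\<close>

text \<open>For finite \<open>'g\<close>, the space \<open>\<ell>\<^sup>2('g) \<otimes> 's\<close> is realised as \<open>'s ^ 'g\<close>, the component
  of a vector at \<open>g\<close> being its \<open>'s\<close>-part along the basis vector \<open>ket g\<close>. The lemmas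
  \<open>cinner_tensor_vec\<close> and \<open>tensor_vec_expansion\<close> say that this is the
  Hilbert space tensor product, and \<open>tensor_op_tensor_vec\<close> that \<open>tensor_op\<close> is the tensor
  product of operators.\<close>

definition ket :: "'g::finite \<Rightarrow> complex ^ 'g"
  where "ket g = axis g 1"

definition tensor_vec :: "complex ^ 'g \<Rightarrow> 's::complex_inner \<Rightarrow> 's ^ 'g::finite"
  where "tensor_vec \<phi> \<psi> = (\<chi> g. (\<phi> $ g) *\<^sub>C \<psi>)"

definition tensor_op ::
  "(complex ^ 'g \<Rightarrow> complex ^ 'g) \<Rightarrow> ('s::complex_inner \<Rightarrow> 's) \<Rightarrow> 's ^ 'g \<Rightarrow> 's ^ 'g::finite"
  where "tensor_op A B \<Psi> = (\<Sum>h\<in>UNIV. tensor_vec (A (ket h)) (B (\<Psi> $ h)))"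

definition ketbra :: "'a::complex_inner \<Rightarrow> 'a \<Rightarrow> 'a \<Rightarrow> 'a"
  where "ketbra \<phi> \<psi> = (\<lambda>x. cinner \<psi> x *\<^sub>C \<phi>)"

lemma cinner_tensor_vec:
  "cinner (tensor_vec \<phi> \<psi>) (tensor_vec \<phi>' \<psi>') = cinner \<phi> \<phi>' * cinner \<psi> \<psi>'"
  by (simp add: cinner_vec_def tensor_vec_def cinner_scaleC_left cinner_scaleC_right
      cinner_complex_def sum_distrib_left mult_ac)

lemma tensor_vec_expansion: "\<Psi> = (\<Sum>g\<in>UNIV. tensor_vec (ket g) (\<Psi> $ g))"
proof -
  have "(\<Sum>g\<in>UNIV. (ket g $ i) *\<^sub>C (\<Psi> $ g)) = (\<Sum>g\<in>UNIV. if g = i then \<Psi> $ g else 0)" for i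
    by (rule sum.cong) (auto simp: ket_def axis_def)
  then show ?thesis
    by (simp add: vec_eq_iff tensor_vec_def)
qed

lemma bounded_clinear_sum:
  assumes "bounded_clinear f"
  shows "f (\<Sum>i\<in>A. c i *\<^sub>C x i) = (\<Sum>i\<in>A. c i *\<^sub>C f (x i))"
  using assms by (simp add: bounded_clinear_def linear_sum bounded_linear.linear)

lemma tensor_op_tensor_vec:
  assumes "bounded_clinear A" and "bounded_clinear B"
  shows "tensor_op A B (tensor_vec \<phi> \<psi>) = tensor_vec (A \<phi>) (B \<psi>)"
proof -
  have "(\<Sum>h\<in>UNIV. (\<phi> $ h) *\<^sub>C ket h) = (\<Sum>h\<in>UNIV. tensor_vec (ket h) (\<phi> $ h))"
    by (rule sum.cong) (simp_all add: tensor_vec_def scaleC_vec_def scaleC_complex_def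
        vec_eq_iff mult_ac)
  also have "\<dots> = \<phi>"
    by (rule tensor_vec_expansion[symmetric])
  finally have A: "A \<phi> = (\<Sum>h\<in>UNIV. (\<phi> $ h) *\<^sub>C A (ket h))"
    using bounded_clinear_sum[OF assms(1), of "\<lambda>h. \<phi> $ h" ket UNIV] by simp
  have B: "B (c *\<^sub>C \<psi>) = c *\<^sub>C B \<psi>" for c
    using assms(2) by (simp add: bounded_clinear_def)
  show ?thesis
    unfolding A by (simp add: tensor_op_def tensor_vec_def vec_eq_iff B scaleC_scaleC
        scaleC_vec_def scaleC_complex_def scaleC_sum_left mult_ac)
qed


section \<open>Quantum reference frames\<close>

text \<open>The finite abelian group is the type \<open>'g\<close>, written additively: \<open>g h\<close> becomes \<open>g + h\<close>
  and \<open>g h\<^sup>-\<^sup>1\<close> becomes \<open>g - h\<close>. Both frames have the state space \<open>complex ^ 'g\<close> and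
  \<open>U\<close> represents the group on the system only, so nothing below depends on which of the two frames
  is the reference; the orientations are \<open>gi\<close> (reference frame) and \<open>gj\<close> (other frame).\<close>

definition op_algebra :: "('a::complex_inner \<Rightarrow> 'a) set"
  where "op_algebra = {f. bounded_clinear f}"

definition frame_change ::
  "('g::{finite,ab_group_add} \<Rightarrow> 's::complex_inner \<Rightarrow> 's) \<Rightarrow> 'g \<Rightarrow> 'g \<Rightarrow> ('s, 'g) vec \<Rightarrow> ('s, 'g) vec"
  where "frame_change U gi gj =
    (\<lambda>\<Psi>. \<Sum>g\<in>UNIV. tensor_op (ketbra (ket (gi + g)) (ket (gj - g))) (U g) \<Psi>)"

definition bilocal_unitary :: "('s::complex_inner ^ 'g \<Rightarrow> 's ^ 'g::finite) \<Rightarrow> bool"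
  where "bilocal_unitary X \<longleftrightarrow> (\<exists>Y Z. unitary Y \<and> unitary Z \<and> X = tensor_op Y Z)"

definition tps_invariant_algebra ::
  "('g::{finite,ab_group_add} \<Rightarrow> 's::complex_inner \<Rightarrow> 's) \<Rightarrow> 'g \<Rightarrow> 'g \<Rightarrow>
    (('s, 'g) vec \<Rightarrow> ('s, 'g) vec) \<Rightarrow> (('s, 'g) vec \<Rightarrow> ('s, 'g) vec) set"
  where "tps_invariant_algebra U gi gj X =
    {f \<in> op_algebra. conj_by (frame_change U gi gj) f = cadjoint X \<circ> f \<circ> X}"

definition twirl ::
  "('g::{finite,ab_group_add} \<Rightarrow> 's::complex_inner \<Rightarrow> 's) \<Rightarrow>
    (('s, 'g) vec \<Rightarrow> ('s, 'g) vec) \<Rightarrow> ('s, 'g) vec \<Rightarrow> ('s, 'g) vec"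
  where "twirl U f =
    (\<lambda>\<Psi>. (1 / real CARD('g)) *\<^sub>R
      (\<Sum>g\<in>UNIV. tensor_op id (U g) (f (tensor_op id (U (- g)) \<Psi>))))"

definition translation_invariant_algebra ::
  "('g::{finite,ab_group_add} \<Rightarrow> 's::complex_inner \<Rightarrow> 's) \<Rightarrow> (('s, 'g) vec \<Rightarrow> ('s, 'g) vec) set"
  where "translation_invariant_algebra U = twirl U ` op_algebra"

end

theory Submission
  imports Defs
begin

text \<open>In components, the frame change sends \<open>\<Psi>\<close> to the vector with \<open>k\<close>-th entry
  \<open>U (k - gi) (\<Psi> $ (gi + gj - k))\<close>. Hence conjugating \<open>1 \<otimes> f\<close> by it yields the block diagonal
  operator with blocks \<open>U g f U (- g)\<close>, one for each group element \<open>g\<close>, while conjugating by a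
  bilocal unitary yields \<open>1 \<otimes> Z\<^sup>\<dagger> f Z\<close>. If the two agree, all the blocks are equal, hence
  equal to \<open>f\<close>, the block at \<open>g = 0\<close>; what remains is \<open>f = Z\<^sup>\<dagger> f Z\<close>.\<close>

section \<open>Boundedness of tensor product operators\<close>

lemma bounded_clinear_id: "bounded_clinear id"
  by (simp add: bounded_clinear_def id_def)

lemma unitary_id: "unitary id"
  by (simp add: unitary_def bounded_clinear_id)

lemma bounded_clinear_compose:
  "bounded_clinear f \<Longrightarrow> bounded_clinear g \<Longrightarrow> bounded_clinear (\<lambda>x. f (g x))"
  by (simp add: bounded_clinear_def bounded_linear_compose)

lemma bounded_clinear_sum_fun:
  "(\<And>i. i \<in> A \<Longrightarrow> bounded_clinear (f i)) \<Longrightarrow> bounded_clinear (\<lambda>x. \<Sum>i\<in>A. f i x)"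
  by (simp add: bounded_clinear_def bounded_linear_sum scaleC_sum_right)

text \<open>The class axioms tie the norm to complex scalars only through
  \<open>cinner_self\<close>, so the squares are compared.\<close>

lemma norm_scaleC: "norm (c *\<^sub>C x) = cmod c * norm (x :: 'a::complex_inner)"
proof -
  have "complex_of_real ((norm (c *\<^sub>C x))\<^sup>2) = cnj c * c * complex_of_real ((norm x)\<^sup>2)"
    by (simp add: cinner_self[symmetric] cinner_scaleC_left cinner_scaleC_right del: of_real_power)
  also have "cnj c * c = complex_of_real ((cmod c)\<^sup>2)"
    by (metis complex_norm_square mult.commute)
  finally have "(norm (c *\<^sub>C x))\<^sup>2 = (cmod c * norm x)\<^sup>2"
    by (simp only: of_real_mult[symmetric] of_real_eq_iff power_mult_distrib)
  then show ?thesis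
    by simp
qed

lemma bounded_clinear_scaleC: "bounded_clinear (\<lambda>x. c *\<^sub>C (x :: 'a::complex_inner))"
  unfolding bounded_clinear_def
proof (intro conjI allI)
  show "bounded_linear (\<lambda>x. c *\<^sub>C (x :: 'a))"
    by (rule bounded_linear_intro[of _ "cmod c"])
      (simp_all add: scaleC_add_right norm_scaleC scaleC_of_real[symmetric] scaleC_scaleC mult.commute)
qed (simp add: scaleC_scaleC mult.commute)

lemma bounded_clinear_vec_nth: "bounded_clinear (\<lambda>\<Psi> :: 's::complex_inner ^ 'g::finite. \<Psi> $ h)"
  by (simp add: bounded_clinear_def scaleC_vec_def bounded_linear_vec_nth)

text \<open>The map is a finite sum of scalings by \<open>\<phi> $ k\<close>, each followed by a
  coordinate embedding \<open>axis k\<close>. The embeddings are isometric, which gives the bound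
  1.\<close>

lemma bounded_clinear_tensor_vec:
  "bounded_clinear (tensor_vec \<phi> :: 's::complex_inner \<Rightarrow> 's ^ 'g::finite)"
proof -
  have "bounded_clinear (\<lambda>x :: 's. axis k x :: 's ^ 'g)" for k
    unfolding bounded_clinear_def
  proof (intro conjI allI)
    show "bounded_linear (\<lambda>x :: 's. axis k x :: 's ^ 'g)"
    proof (rule bounded_linear_intro[of _ 1])
      fix x :: 's
      have "(\<Sum>i\<in>UNIV. (norm ((axis k x :: 's ^ 'g) $ i))\<^sup>2)
          = (\<Sum>i\<in>UNIV. if i = k then (norm x)\<^sup>2 else 0)"
        by (rule sum.cong) (auto simp: axis_def)
      then show "norm (axis k x :: 's ^ 'g) \<le> norm x * 1"
        by (simp add: norm_vec_def L2_set_def)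
    qed (simp_all add: vec_eq_iff axis_def)
  qed (simp add: vec_eq_iff axis_def scaleC_vec_def)
  then have "bounded_clinear (\<lambda>x. \<Sum>k\<in>UNIV. axis k (\<phi> $ k *\<^sub>C x) :: 's ^ 'g)"
    by (intro bounded_clinear_sum_fun bounded_clinear_compose[OF _ bounded_clinear_scaleC])
  moreover have "(\<lambda>x :: 's. \<Sum>k\<in>UNIV. axis k (\<phi> $ k *\<^sub>C x)) = tensor_vec \<phi>"
    by (simp add: fun_eq_iff vec_eq_iff tensor_vec_def axis_def)
  ultimately show ?thesis
    by simp
qed

lemma bounded_clinear_tensor_op:
  assumes "bounded_clinear B"
  shows "bounded_clinear (tensor_op A B)"
  unfolding tensor_op_def
  by (intro bounded_clinear_sum_fun bounded_clinear_compose[OF bounded_clinear_tensor_vec]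
      bounded_clinear_compose[OF assms] bounded_clinear_vec_nth)

lemma bounded_clinear_imp_linear: "bounded_clinear f \<Longrightarrow> linear f"
  by (simp add: bounded_clinear_def bounded_linear.linear)

lemmas linear_tensor_op = bounded_clinear_imp_linear[OF bounded_clinear_tensor_op]

section \<open>Products and components of tensor product operators\<close>

lemma tensor_op_compose:
  assumes "bounded_clinear A" and "bounded_clinear B"
  shows "tensor_op A B \<circ> tensor_op C D = tensor_op (A \<circ> C) (B \<circ> D)"
proof
  fix \<Psi>
  show "(tensor_op A B \<circ> tensor_op C D) \<Psi> = tensor_op (A \<circ> C) (B \<circ> D) \<Psi>"
    \<comment> \<open>Only the inner operator is expanded: by linearity the outer one moves inside
      the sum, where it meets product vectors.\<close>
    by (simp add: tensor_op_def[of C] linear_sum[OF linear_tensor_op[OF assms(2)]]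
        tensor_op_tensor_vec[OF assms])
      (simp add: tensor_op_def)
qed

lemma tensor_op_nth: "tensor_op A B \<Psi> $ k = (\<Sum>h\<in>UNIV. (A (ket h) $ k) *\<^sub>C B (\<Psi> $ h))"
  by (simp add: tensor_op_def tensor_vec_def)

lemma tensor_op_id_nth: "tensor_op id B \<Psi> $ k = B (\<Psi> $ k)"
proof -
  \<comment> \<open>Writing \<open>B (\<Psi> $ h)\<close> as a component of a vector gives the sum
    the shape of \<open>tensor_vec_expansion\<close>, to be read backwards.\<close>
  have "tensor_op id B \<Psi> = (\<Sum>h\<in>UNIV. tensor_vec (ket h) ((\<chi> h. B (\<Psi> $ h)) $ h))"
    by (simp add: tensor_op_def)
  also have "\<dots> = (\<chi> h. B (\<Psi> $ h))"
    by (rule tensor_vec_expansion[symmetric])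
  finally show ?thesis
    by simp
qed

section \<open>Adjoints of unitaries and of their tensor products\<close>

lemma cinner_sum_right: "cinner x (\<Sum>i\<in>A. f i) = (\<Sum>i\<in>A. cinner x (f i :: 'a::complex_inner))"
  by (induction A rule: infinite_finite_induct) (simp_all add: cinner_add_right)

lemma cinner_sum_left: "cinner (\<Sum>i\<in>A. f i) x = (\<Sum>i\<in>A. cinner (f i :: 'a::complex_inner) x)"
  by (simp add: cinner_commute[of _ x] cinner_sum_right)

lemma cinner_ket_left: "cinner (ket h) x = x $ h"
proof -
  have "cinner (ket h) x = (\<Sum>i\<in>UNIV. if i = h then x $ i else 0)"
    unfolding cinner_vec_def by (rule sum.cong) (auto simp: ket_def axis_def cinner_complex_def)
  then show ?thesis
    by simp
qed

text \<open>As \<open>cadjoint\<close> is defined by choice, even additivity needs an argument: the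
  adjoint is the two-sided inverse of \<open>W\<close> and inherits linearity from it. Boundedness
  follows from isometry.\<close>

lemma unitary_cadjoint_unitary:
  assumes "unitary W"
  shows "unitary (cadjoint W)"
proof -
  note adj = unitary_cadjoint(1)[OF assms]
  have WW: "W (cadjoint W x) = x" and WW': "cadjoint W (W x) = x" for x
    using unitary_cadjoint(2,3)[OF assms] by (simp_all add: fun_eq_iff)
  have iso: "cinner (cadjoint W x) (cadjoint W y) = cinner x y" for x y
    by (simp add: adj WW)
  have W: "linear W" "\<And>c x. W (c *\<^sub>C x) = c *\<^sub>C W x"
    using assms by (auto simp: unitary_def bounded_clinear_def bounded_linear.linear)
  have "norm (cadjoint W x) = norm x" for x
  proof -
    have "(norm (cadjoint W x))\<^sup>2 = (norm x)\<^sup>2"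
      using iso[of x x] unfolding cinner_self of_real_eq_iff .
    then show ?thesis
      by simp
  qed
  moreover have "cadjoint W (x + y) = cadjoint W x + cadjoint W y" for x y
    by (metis WW WW' linear_add[OF W(1)])
  moreover have C: "cadjoint W (c *\<^sub>C x) = c *\<^sub>C cadjoint W x" for c x
    by (metis WW WW' W(2))
  moreover have "cadjoint W (r *\<^sub>R x) = r *\<^sub>R cadjoint W x" for r x
    using C[of "complex_of_real r" x] by (simp add: scaleC_of_real)
  ultimately have "bounded_linear (cadjoint W)"
    by (intro bounded_linear_intro[of _ 1]) simp_all
  with C iso show ?thesis
    unfolding unitary_def bounded_clinear_def by (metis WW' surjI)
qed

text \<open>Adjoints are unique, so checking the defining identity suffices. In the basis of kets
  the matrix of \<open>cadjoint Y\<close> is the conjugate transpose of that of \<open>Y\<close>,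
  and exchanging the two sums gives the identity.\<close>

lemma cadjoint_tensor_op:
  assumes "unitary Y" and "unitary Z"
  shows "cadjoint (tensor_op Y Z) = tensor_op (cadjoint Y) (cadjoint Z)"
proof (rule cadjoint_eqI)
  fix \<Phi> \<Psi>
  have Y: "cnj (cadjoint Y (ket h) $ k) = Y (ket k) $ h" for h k
    using unitary_cadjoint(1)[OF assms(1), of "ket h" "ket k"]
    by (simp add: cinner_commute[of _ "ket k"] cinner_ket_left)
  have "cinner (tensor_op (cadjoint Y) (cadjoint Z) \<Phi>) \<Psi> =
      (\<Sum>k\<in>UNIV. \<Sum>h\<in>UNIV. (Y (ket k) $ h) * cinner (\<Phi> $ h) (Z (\<Psi> $ k)))"
    by (simp add: cinner_vec_def tensor_op_nth cinner_sum_left cinner_scaleC_left Y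
        unitary_cadjoint(1)[OF assms(2)])
  also have "\<dots> = cinner \<Phi> (tensor_op Y Z \<Psi>)"
    by (subst sum.swap)
      (simp add: cinner_vec_def tensor_op_nth cinner_sum_right cinner_scaleC_right)
  finally show "cinner (tensor_op (cadjoint Y) (cadjoint Z) \<Phi>) \<Psi> = cinner \<Phi> (tensor_op Y Z \<Psi>)" .
qed

text \<open>Composition works factor by factor, and on the frame \<open>cadjoint Y \<circ> Y\<close>
  is the identity. This is why \<open>Y\<close> remains arbitrary in the theorem.\<close>

lemma conj_tensor_op_id:
  assumes "unitary Y" and "unitary Z" and "bounded_clinear f"
  shows "cadjoint (tensor_op Y Z) \<circ> tensor_op id f \<circ> tensor_op Y Z
    = tensor_op id (cadjoint Z \<circ> f \<circ> Z)"
proof -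
  have "bounded_clinear (cadjoint Y)" and "bounded_clinear (cadjoint Z)"
    using unitary_cadjoint_unitary assms(1,2) by (auto simp: unitary_def)
  moreover from this have "bounded_clinear (cadjoint Z \<circ> f)"
    using assms(3) by (simp add: comp_def bounded_clinear_compose)
  ultimately show ?thesis
    by (simp add: cadjoint_tensor_op[OF assms(1,2)] tensor_op_compose
        unitary_cadjoint(3)[OF assms(1)])
qed

section \<open>The frame change and its invariant subalgebras\<close>

context
  fixes U :: "'g::{finite,ab_group_add} \<Rightarrow> 's::complex_inner \<Rightarrow> 's"
  assumes rep: "unitary_rep U"
begin

lemma rep_zero: "U 0 x = x"
  using rep by (simp add: unitary_rep_def)

lemma rep_add: "U (g + h) x = U g (U h x)"
  using rep by (simp add: unitary_rep_def)

lemma rep_bounded_clinear: "bounded_clinear (U g)"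
  using rep by (simp add: unitary_rep_def unitary_def)

lemma rep_minus_left: "U (- g) (U g x) = x"
  by (simp add: rep_add[symmetric] rep_zero)

lemma rep_minus_right: "U g (U (- g) x) = x"
  by (simp add: rep_add[symmetric] rep_zero)

lemma rep_adjoint: "cinner (U (- g) x) y = cinner x (U g y)"
proof -
  have "cinner (U (- g) x) y = cinner (U g (U (- g) x)) (U g y)"
    using rep by (simp add: unitary_rep_def unitary_def)
  then show ?thesis
    by (simp add: rep_minus_right)
qed

lemma frame_change_nth: "frame_change U gi gj \<Psi> $ k = U (k - gi) (\<Psi> $ (gi + gj - k))"
proof -
  \<comment> \<open>The conditions are nested so that the one on \<open>h\<close> collapses the sum
    over kets first, and the one on \<open>g\<close> then collapses the sum over the group.\<close>
  have inner: "(ketbra (ket (gi + g)) (ket (gj - g)) (ket h) $ k) *\<^sub>C x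
      = (if h = gj - g then if g = k - gi then x else 0 else 0)" for g h and x :: 's
    by (auto simp: ketbra_def cinner_ket_left scaleC_vec_def scaleC_complex_def)
      (auto simp: ket_def axis_def algebra_simps)
  have "frame_change U gi gj \<Psi> $ k
      = (\<Sum>g\<in>UNIV. if g = k - gi then U g (\<Psi> $ (gj - g)) else 0)"
    by (simp add: frame_change_def tensor_op_nth inner)
  also have "\<dots> = U (k - gi) (\<Psi> $ (gj - (k - gi)))"
    by simp
  also have "gj - (k - gi) = gi + gj - k"
    by (simp add: algebra_simps)
  finally show ?thesis .
qed

text \<open>The frame change reflects indices by \<open>k = gi + gj - h\<close>, an involution under
  which \<open>k - gi\<close> becomes \<open>gj - h\<close>. Reindexing the inner product by it
  exhibits the adjoint.\<close>

lemma cadjoint_frame_change_nth: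
  "cadjoint (frame_change U gi gj) \<Phi> $ h = U (- (gj - h)) (\<Phi> $ (gi + gj - h))"
proof -
  have "cadjoint (frame_change U gi gj) = (\<lambda>\<Phi>. \<chi> h. U (- (gj - h)) (\<Phi> $ (gi + gj - h)))"
  proof (rule cadjoint_eqI)
    fix \<Phi> \<Psi> :: "('s, 'g) vec"
    have "(\<Sum>h\<in>UNIV. cinner (\<Phi> $ (gi + gj - h)) (U (gj - h) (\<Psi> $ h)))
        = (\<Sum>k\<in>UNIV. cinner (\<Phi> $ k) (U (k - gi) (\<Psi> $ (gi + gj - k))))"
      by (rule sum.reindex_bij_witness[where i = "\<lambda>k. gi + gj - k" and j = "\<lambda>h. gi + gj - h"])
        (simp_all add: algebra_simps)
    then show "cinner (\<chi> h. U (- (gj - h)) (\<Phi> $ (gi + gj - h))) \<Psi>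
        = cinner \<Phi> (frame_change U gi gj \<Psi>)"
      unfolding cinner_vec_def frame_change_nth vec_lambda_beta rep_adjoint .
  qed
  then show ?thesis
    by simp
qed

lemma conj_by_frame_change_nth:
  "conj_by (frame_change U gi gj) (tensor_op id f) \<Psi> $ k
    = U (k - gi) (f (U (- (k - gi)) (\<Psi> $ k)))"
proof -
  \<comment> \<open>Two reflections return the index to \<open>k\<close>, and the two group elements
    acting on the system become mutually inverse.\<close>
  have "gj - (gi + gj - k) = k - gi" and "gi + gj - (gi + gj - k) = k"
    by (simp_all add: algebra_simps)
  then show ?thesis
    unfolding conj_by_def comp_def frame_change_nth tensor_op_id_nth cadjoint_frame_change_nth
    by (simp only:)
qed

text \<open>The orientations disappear because \<open>gj\<close> drops out of the conjugated
  operator and \<open>k - gi\<close> runs through the whole group as \<open>k\<close>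
  varies.\<close>

lemma tensor_op_id_in_tps_invariant_algebra_iff:
  assumes f: "bounded_clinear f" and "unitary Y" and "unitary Z"
  shows "tensor_op id f \<in> tps_invariant_algebra U gi gj (tensor_op Y Z) \<longleftrightarrow>
    (\<forall>g x. f (U g x) = U g (f x)) \<and> (\<forall>x. Z (f x) = f (Z x))"
    (is "?L \<longleftrightarrow> ?R")
proof -
  have ZZ: "Z (cadjoint Z x) = x" "cadjoint Z (Z x) = x" for x
    using unitary_cadjoint(2,3)[OF assms(3)] by (simp_all add: fun_eq_iff)
  have "?L \<longleftrightarrow> conj_by (frame_change U gi gj) (tensor_op id f)
      = tensor_op id (cadjoint Z \<circ> f \<circ> Z)"
    by (simp add: tps_invariant_algebra_def op_algebra_def bounded_clinear_tensor_op[OF f]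
        conj_tensor_op_id[OF assms(2,3) f])
  also have "\<dots> \<longleftrightarrow>
      (\<forall>\<Psi> k. U (k - gi) (f (U (- (k - gi)) (\<Psi> $ k))) = cadjoint Z (f (Z (\<Psi> $ k))))"
    unfolding fun_eq_iff[where 'a = "('s, 'g) vec"] vec_eq_iff conj_by_frame_change_nth tensor_op_id_nth
    by simp
  also have "\<dots> \<longleftrightarrow> (\<forall>g x. U g (f (U (- g) x)) = cadjoint Z (f (Z x)))"
  proof
    assume eq: "\<forall>\<Psi> k. U (k - gi) (f (U (- (k - gi)) (\<Psi> $ k))) = cadjoint Z (f (Z (\<Psi> $ k)))"
    show "\<forall>g x. U g (f (U (- g) x)) = cadjoint Z (f (Z x))"
    proof (intro allI)
      fix g x
      \<comment> \<open>Component \<open>g + gi\<close> carries the block of \<open>g\<close>; a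
        constant vector places the arbitrary \<open>x\<close> there.\<close>
      show "U g (f (U (- g) x)) = cadjoint Z (f (Z x))"
        using eq[rule_format, of "g + gi" "\<chi> h. x"] by simp
    qed
  next
    assume eq: "\<forall>g x. U g (f (U (- g) x)) = cadjoint Z (f (Z x))"
    show "\<forall>\<Psi> k. U (k - gi) (f (U (- (k - gi)) (\<Psi> $ k))) = cadjoint Z (f (Z (\<Psi> $ k)))"
      by (intro allI) (rule eq[rule_format])
  qed
  also have "\<dots> \<longleftrightarrow> ?R"
  proof
    assume eq: "\<forall>g x. U g (f (U (- g) x)) = cadjoint Z (f (Z x))"
    then have Z: "f x = cadjoint Z (f (Z x))" for x
      by (metis minus_zero rep_zero)
    have "U g (f (U (- g) x)) = f x" for g x
      using eq[rule_format, of g x] Z[of x] by (rule trans[OF _ sym])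
    \<comment> \<open>Put \<open>U g x\<close> in place of \<open>x\<close> to cancel the inverse
      translation.\<close>
    then have "f (U g x) = U g (f x)" for g x
      by (metis rep_minus_left)
    moreover have "Z (f x) = f (Z x)" for x
      using arg_cong[OF Z[of x], of Z] unfolding ZZ .
    ultimately show ?R
      by blast
  next
    assume R: ?R
    then have "cadjoint Z (f (Z x)) = f x" for x
      by (metis ZZ(2))
    with R show "\<forall>g x. U g (f (U (- g) x)) = cadjoint Z (f (Z x))"
      by (simp add: rep_minus_right)
  qed
  finally show ?thesis .
qed

section \<open>The twirl and translation invariance\<close>

lemma twirl_commute:
  "tensor_op id (U a) (twirl U F \<Psi>) = twirl U F (tensor_op id (U a) \<Psi>)"
proof -
  have add: "tensor_op id (U g) (tensor_op id (U h) \<Phi>) = tensor_op id (U (g + h)) \<Phi>" for g h \<Phi>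
    by (simp add: vec_eq_iff tensor_op_id_nth rep_add)
  note linear = linear_tensor_op[OF rep_bounded_clinear]
  have "tensor_op id (U a) (twirl U F \<Psi>) = (1 / real CARD('g)) *\<^sub>R
      (\<Sum>g\<in>UNIV. tensor_op id (U (a + g)) (F (tensor_op id (U (- g)) \<Psi>)))"
    by (simp add: twirl_def linear_cmul[OF linear] linear_sum[OF linear] add)
  \<comment> \<open>Shifting the summation index by \<open>a\<close> moves the translation from the
    left of \<open>F\<close> to its right.\<close>
  also have "(\<Sum>g\<in>UNIV. tensor_op id (U (a + g)) (F (tensor_op id (U (- g)) \<Psi>)))
      = (\<Sum>g\<in>UNIV. tensor_op id (U g) (F (tensor_op id (U (- g + a)) \<Psi>)))"
    by (rule sum.reindex_bij_witness[where i = "\<lambda>g. g - a" and j = "\<lambda>g. a + g"]) simp_all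
  finally show ?thesis
    unfolding twirl_def add .
qed

text \<open>Every twirled operator commutes with the translations of the system, and constant
  vectors transfer this to \<open>f\<close>. Conversely, an invariant operator is fixed by the
  twirl, which averages equal terms, so it is its own preimage.\<close>

lemma tensor_op_id_in_translation_invariant_algebra_iff:
  assumes f: "bounded_clinear f"
  shows "tensor_op id f \<in> translation_invariant_algebra U \<longleftrightarrow> (\<forall>g x. f (U g x) = U g (f x))"
proof
  assume "tensor_op id f \<in> translation_invariant_algebra U"
  then obtain F where F: "tensor_op id f = twirl U F"
    by (auto simp: translation_invariant_algebra_def)
  show "\<forall>g x. f (U g x) = U g (f x)"
  proof (intro allI)
    fix g x
    have "tensor_op id (U g) (tensor_op id f ((\<chi> h. x) :: ('s, 'g) vec))
        = tensor_op id f (tensor_op id (U g) (\<chi> h. x))"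
      unfolding F by (rule twirl_commute)
    then show "f (U g x) = U g (f x)"
      by (simp add: vec_eq_iff tensor_op_id_nth)
  qed
next
  assume "\<forall>g x. f (U g x) = U g (f x)"
  then have "tensor_op id (U g) (tensor_op id f (tensor_op id (U (- g)) \<Psi>)) = tensor_op id f \<Psi>"
    for g and \<Psi> :: "('s, 'g) vec"
    by (simp add: vec_eq_iff tensor_op_id_nth rep_minus_right)
  then have "twirl U (tensor_op id f) = tensor_op id f"
    by (simp add: twirl_def sum_constant_scaleR)
  moreover have "tensor_op id f \<in> op_algebra"
    by (simp add: op_algebra_def bounded_clinear_tensor_op[OF f])
  ultimately show "tensor_op id f \<in> translation_invariant_algebra U"
    unfolding translation_invariant_algebra_def by (metis image_eqI)
qed

end

theorem theorem2:
  fixes U :: "'g::{finite,ab_group_add} \<Rightarrow> 's::chilbert_space \<Rightarrow> 's"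
    and fS :: "'s \<Rightarrow> 's"
  assumes "CARD('g) \<noteq> 1"
    and "unitary_rep U"
    and "bounded_clinear fS"
  shows "((\<exists>X gi gj. bilocal_unitary X \<and>
              tensor_op id fS \<in> tps_invariant_algebra U gi gj X)
            \<longleftrightarrow> tensor_op id fS \<in> translation_invariant_algebra U)
       \<and> (tensor_op id fS \<in> translation_invariant_algebra U
            \<longleftrightarrow> (\<forall>g. commutator fS (U g) = (\<lambda>_. 0)))
       \<and> (tensor_op id fS \<in> translation_invariant_algebra U \<longrightarrow>
            (\<forall>gi gj Y Z. unitary Y \<longrightarrow> unitary Z \<longrightarrow>
              (tensor_op id fS \<in> tps_invariant_algebra U gi gj (tensor_op Y Z)
                \<longleftrightarrow> commutator Z fS = (\<lambda>_. 0))))"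
proof -
  note tps = tensor_op_id_in_tps_invariant_algebra_iff[OF assms(2,3)]
  note transl = tensor_op_id_in_translation_invariant_algebra_iff[OF assms(2,3)]
  have "(\<exists>X gi gj. bilocal_unitary X \<and> tensor_op id fS \<in> tps_invariant_algebra U gi gj X)
      \<longleftrightarrow> (\<forall>g x. fS (U g x) = U g (fS x))"
  proof
    assume "\<forall>g x. fS (U g x) = U g (fS x)"
    \<comment> \<open>With \<open>Z = id\<close> the condition on \<open>Z\<close> is trivial,
      leaving exactly the assumed invariance; the orientations may be any, here 0.\<close>
    then have "tensor_op id fS \<in> tps_invariant_algebra U 0 0 (tensor_op id id)"
      by (simp add: tps[OF unitary_id unitary_id])
    then show "\<exists>X gi gj. bilocal_unitary X \<and> tensor_op id fS \<in> tps_invariant_algebra U gi gj X"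
      unfolding bilocal_unitary_def by (blast intro: unitary_id)
  qed (auto simp: bilocal_unitary_def tps)
  then show ?thesis
    \<comment> \<open>In the last claim invariance of \<open>fS\<close> already supplies the first
      conjunct of \<open>tps\<close>, so only commutation with \<open>Z\<close> is left.\<close>
    by (simp add: transl tps commutator_def fun_eq_iff)
qed

end
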